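(* Let $G$ be a finite abstract simplicial complex and let $h: G\to\mathbb{R}$ be any function. Then the total energy $E[G]=\sum_{x\in G}h(x)$ satisfies $$E[G]=\operatorname{tr}(Sg)=\operatorname{str}(g),$$ where $g=SL^{++}S$.
   Context: A finite abstract simplicial complex $G$ is a finite set of finite non-empty sets closed under the operation of taking non-empty subsets. For $x\in G$ let $W^+(x)=\{y\in G: x\subset y\}$ (including $x$). Let $|x|$ be the cardinality of $x$, $\dim(x)=|x|-1$ and $\omega(x)=(-1)^{\dim(x)}$. For $A\subset G$ put $E[A]=\sum_{x\in A}h(x)$ (with $E[\emptyset]=0$). The matrices, indexed by $G\times G$, are $L^{++}(x,y)=E[W^+(x)\cap W^+(y)]$ and $S(x,y)=\omega(x)$ if $x=y$ and $0$ otherwise. The super trace of a matrix $A$ indexed by $G\times G$ is by definition $\operatorname{str}(A)=\operatorname{tr}(SA)$. *)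

theory Defs
  imports Complex_Main
begin

definition simplicial_complex :: "'a set set \<Rightarrow> bool" where
  "simplicial_complex G \<longleftrightarrow>
     finite G \<and> (\<forall>x\<in>G. finite x \<and> x \<noteq> {}) \<and>
     (\<forall>x\<in>G. \<forall>y. y \<subseteq> x \<and> y \<noteq> {} \<longrightarrow> y \<in> G)"

text \<open>A matrix indexed by \<open>I \<times> I\<close>, for a finite set \<open>I\<close>, is a function of two arguments of which
  only the values on \<open>I \<times> I\<close> are relevant; the index set is an argument of the operations.\<close>

type_synonym 'i matrix = "'i \<Rightarrow> 'i \<Rightarrow> real"

definition matrix_mult :: "'i set \<Rightarrow> 'i matrix \<Rightarrow> 'i matrix \<Rightarrow> 'i matrix" where
  "matrix_mult I A B = (\<lambda>x y. \<Sum>z\<in>I. A x z * B z y)"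

definition matrix_trace :: "'i set \<Rightarrow> 'i matrix \<Rightarrow> real" where
  "matrix_trace I A = (\<Sum>x\<in>I. A x x)"

text \<open>Simplices are finite and non-empty, so the subtraction on \<open>nat\<close> does not truncate.\<close>

definition simplex_dim :: "'a set \<Rightarrow> nat" where
  "simplex_dim x = card x - 1"

definition omega :: "'a set \<Rightarrow> real" where
  "omega x = (-1) ^ simplex_dim x"

definition star :: "'a set set \<Rightarrow> 'a set \<Rightarrow> 'a set set" where
  "star G x = {y \<in> G. x \<subseteq> y}"

definition energy :: "('a set \<Rightarrow> real) \<Rightarrow> 'a set set \<Rightarrow> real" where
  "energy h A = (\<Sum>x\<in>A. h x)"

definition L_plus :: "'a set set \<Rightarrow> ('a set \<Rightarrow> real) \<Rightarrow> 'a set matrix" where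
  "L_plus G h = (\<lambda>x y. energy h (star G x \<inter> star G y))"

definition S_matrix :: "'a set matrix" where
  "S_matrix = (\<lambda>x y. if x = y then omega x else 0)"

definition super_trace :: "'a set set \<Rightarrow> 'a set matrix \<Rightarrow> real" where
  "super_trace G A = matrix_trace G (matrix_mult G S_matrix A)"

definition green :: "'a set set \<Rightarrow> ('a set \<Rightarrow> real) \<Rightarrow> 'a set matrix" where
  "green G h = matrix_mult G (matrix_mult G S_matrix (L_plus G h)) S_matrix"

end

theory Submission imports Defs begin

text \<open>Conjugation by \<open>S\<close> does not change a diagonal entry, because \<open>\<omega>(x)\<^sup>2 = 1\<close>. Hence the super
  trace of \<open>g\<close> is the sum of \<open>\<omega>(x) E[W\<^sup>+(x)]\<close> over all simplices \<open>x\<close>. Exchanging the two summations,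
  the value \<open>h(y)\<close> of a simplex \<open>y\<close> is counted once, with sign \<open>\<omega>(x)\<close>, for every non-empty face \<open>x\<close>
  of \<open>y\<close>. The total weight of \<open>h(y)\<close> is therefore the Euler characteristic of the full simplex \<open>y\<close>,
  which is \<open>1\<close> (\<open>sum_omega_faces\<close>), and what remains is \<open>E[G]\<close>.\<close>

lemma omega_mult_self: "omega x * omega x = 1"
  by (simp add: omega_def flip: power_mult_distrib)

lemma omega_eq_minus_power_card:
  assumes "finite x" "x \<noteq> {}"
  shows "omega x = - ((-1) ^ card x)"
  using assms by (cases "card x") (auto simp: omega_def simplex_dim_def)

text \<open>Expanding the vanishing product of the factors \<open>-1 + 1\<close> over the vertices of \<open>y\<close> produces one
  signed term for every subset of \<open>y\<close>. The empty subset contributes \<open>1\<close>, so the non-empty ones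
  sum to \<open>-1\<close>, and \<open>\<omega>\<close> has the opposite sign on each of them.\<close>

lemma sum_omega_faces:
  assumes "finite y" "y \<noteq> {}"
  shows "(\<Sum>x\<in>Pow y - {{}}. omega x) = 1"
proof -
  have "(\<Sum>x\<in>Pow y. (-1) ^ card x) = (\<Prod>v\<in>y. - 1 + 1 :: real)"
    using prod_add[OF \<open>finite y\<close>, of "\<lambda>_. - 1 :: real" "\<lambda>_. 1"] by simp
  also have "\<dots> = 0"
    using assms by (simp add: card_gt_0_iff)
  finally have "(\<Sum>x\<in>Pow y - {{}}. (-1 :: real) ^ card x) = - 1"
    using \<open>finite y\<close> by (simp add: sum_diff1)
  moreover have "(\<Sum>x\<in>Pow y - {{}}. omega x) = (\<Sum>x\<in>Pow y - {{}}. - ((-1) ^ card x))"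
    using \<open>finite y\<close> by (intro sum.cong) (auto intro: omega_eq_minus_power_card finite_subset)
  ultimately show ?thesis
    by (simp add: sum_negf)
qed

lemma faces_in_complex:
  assumes "simplicial_complex G" "y \<in> G"
  shows "{x \<in> G. x \<subseteq> y} = Pow y - {{}}"
  using assms unfolding simplicial_complex_def by blast

lemma matrix_mult_S_left:
  assumes "finite I" "x \<in> I"
  shows "matrix_mult I S_matrix A x y = omega x * A x y"
proof -
  have "matrix_mult I S_matrix A x y = (\<Sum>z\<in>I. if x = z then omega x * A z y else 0)"
    unfolding matrix_mult_def S_matrix_def by (intro sum.cong) auto
  also have "\<dots> = omega x * A x y"
    using assms by simp
  finally show ?thesis .
qed

lemma matrix_mult_S_right:
  assumes "finite I" "y \<in> I"
  shows "matrix_mult I A S_matrix x y = A x y * omega y"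
proof -
  have "matrix_mult I A S_matrix x y = (\<Sum>z\<in>I. if z = y then A x z * omega z else 0)"
    unfolding matrix_mult_def S_matrix_def by (intro sum.cong) auto
  also have "\<dots> = A x y * omega y"
    using assms by simp
  finally show ?thesis .
qed

lemma green_diagonal:
  assumes "finite G" "x \<in> G"
  shows "green G h x x = energy h (star G x)"
proof -
  have "green G h x x = omega x * omega x * L_plus G h x x"
    using assms by (simp add: green_def matrix_mult_S_left matrix_mult_S_right)
  then show ?thesis
    by (simp add: omega_mult_self L_plus_def)
qed

lemma super_trace_eq_sum_diagonal:
  assumes "finite G"
  shows "super_trace G A = (\<Sum>x\<in>G. omega x * A x x)"
  using assms by (simp add: super_trace_def matrix_trace_def matrix_mult_S_left)

theorem theorem6:
  fixes G :: "'a set set" and h :: "'a set \<Rightarrow> real"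
  assumes "simplicial_complex G"
  shows "energy h G = matrix_trace G (matrix_mult G S_matrix (green G h)) \<and>
         matrix_trace G (matrix_mult G S_matrix (green G h)) = super_trace G (green G h)"
proof -
  have simplex: "finite y" "y \<noteq> {}" if "y \<in> G" for y
    using assms that by (auto simp: simplicial_complex_def)
  have fin: "finite G"
    using assms by (simp add: simplicial_complex_def)
  have "super_trace G (green G h) = (\<Sum>x\<in>G. \<Sum>y | y \<in> G \<and> x \<subseteq> y. omega x * h y)"
    using fin by (simp add: super_trace_eq_sum_diagonal green_diagonal energy_def star_def sum_distrib_left)
  also have "\<dots> = (\<Sum>y\<in>G. \<Sum>x | x \<in> G \<and> x \<subseteq> y. omega x * h y)"
    using fin by (intro sum.swap_restrict)
  also have "\<dots> = (\<Sum>y\<in>G. (\<Sum>x\<in>Pow y - {{}}. omega x) * h y)"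
    using assms by (simp add: faces_in_complex sum_distrib_right)
  also have "\<dots> = energy h G"
    by (simp add: sum_omega_faces simplex energy_def)
  finally show ?thesis
    by (simp add: super_trace_def)
qed

end
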